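(* Consider the market of the context with two areas $A=\{a_1,a_2\}$ connected by a single link, $\mathbb{S}=\hat{\mathbb{X}}_{a_1}=\hat{\mathbb{X}}_{a_2}=\{0,1\}$ and $\chi'=0$. Area $a_1$ has two possible bids $b_{a_1}^1,b_{a_1}^2$ with $b_{a_1}^1(1)=1$, $b_{a_1}^2(1)=0$, and area $a_2$ has two possible bids $b_{a_2}^1,b_{a_2}^2$ with $b_{a_2}^1(1)=-1$, $b_{a_2}^2(1)=0$; all bids are zero at $0$. Then there are no functions $h_{a_1}:\{b_{a_2}^1,b_{a_2}^2\}\to\mathbb{R}$ and $h_{a_2}:\{b_{a_1}^1,b_{a_1}^2\}\to\mathbb{R}$ for which the Groves payment is strongly budget balanced, i.e. satisfies $p_{a_1}(\mathcal{B})+p_{a_2}(\mathcal{B})=0$ for all four bid profiles $\mathcal{B}=\{b_{a_1}^i,b_{a_2}^j\}$, $i,j\in\{1,2\}$. Consequently, for no $\epsilon\ge0$ and no choice of $h_{a_1},h_{a_2}$ is the Groves payment $\epsilon$-coalitionally stable at all four bid profiles.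
   Context: The allocation variable is $\chi\in\mathbb{S}=\{0,1\}$, shared by both areas. For a bid profile $\mathcal{B}=\{b_{a_1},b_{a_2}\}$, $V(\mathcal{B})=\max_{\chi\in\{0,1\}}\big(b_{a_1}(\chi)+b_{a_2}(\chi)\big)$ and $\chi^*(\mathcal{B})$ is a maximizer (selected by a fixed tie-breaking rule). A single area cannot change the default $\chi'=0$, so $V(\mathcal{B}_{a})=0$ for each single area $a$ (and $V=0$ for the empty coalition). The Groves payment is $p_{a}(\mathcal{B})=b_a(\chi^*(\mathcal{B}))-(V(\mathcal{B})-h_a(\mathcal{B}_{-a}))$, where $\mathcal{B}_{-a}$ is the bid of the other area and $h_a(\mathcal{B}_{-a})\in\mathbb{R}$. Revealed utilities are $\bar u_a(\mathcal{B})=b_a(\chi^*(\mathcal{B}))-p_a(\mathcal{B})$. For $\epsilon\ge0$, a payment rule is $\epsilon$-coalitionally stable at $\mathcal{B}$ if $\{\bar u_a(\mathcal{B})\}_{a\in A}\in K_{\mathrm{Core}}(\mathcal{B},\epsilon)=\{\bar u\in\mathbb{R}^A : \sum_{a\in A}\bar u_a=V(\mathcal{B}),\ \sum_{a\in S}\bar u_a\ge V(\mathcal{B}_S)-\epsilon\ \ \forall S\subset A\}$, where $S\subset A$ means proper subset. *)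

theory Defs
  imports Complex_Main "HOL-Library.Z2"
begin

datatype area = A1 | A2

abbreviation areas :: "area set" where
  "areas \<equiv> {A1, A2}"

fun other :: "area \<Rightarrow> area" where
  "other A1 = A2"
| "other A2 = A1"

text \<open>Allocations form the two-element type \<^typ>\<open>bit\<close>, of which only the constants
  0 (the default) and 1 are used, not the field structure.\<close>

type_synonym bid = "bit \<Rightarrow> real"
type_synonym profile = "area \<Rightarrow> bid"
type_synonym payment_rule = "profile \<Rightarrow> area \<Rightarrow> real"

definition profile :: "bid \<Rightarrow> bid \<Rightarrow> profile" where
  "profile b\<^sub>1 b\<^sub>2 = (\<lambda>a. case a of A1 \<Rightarrow> b\<^sub>1 | A2 \<Rightarrow> b\<^sub>2)"

text \<open>Only both areas together can move the allocation away from the default 0.\<close>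

definition attainable :: "area set \<Rightarrow> bit set" where
  "attainable S = (if S = areas then {0, 1} else {0})"

definition coalition_value :: "profile \<Rightarrow> area set \<Rightarrow> real" where
  "coalition_value B S = Max ((\<lambda>\<chi>. \<Sum>a\<in>S. B a \<chi>) ` attainable S)"

lemma coalition_value_proper:
  assumes "S \<subset> areas" and "\<And>a. B a 0 = 0"
  shows "coalition_value B S = 0"
  using assms by (simp add: coalition_value_def attainable_def)

lemma coalition_value_areas:
  "coalition_value B areas = Max ((\<lambda>\<chi>. B A1 \<chi> + B A2 \<chi>) ` {0, 1})"
  by (simp add: coalition_value_def attainable_def)

text \<open>A tie-breaking rule is any selection of a maximizer for every bid profile.\<close>

definition maximizer_selection :: "(profile \<Rightarrow> bit) \<Rightarrow> bool" where
  "maximizer_selection \<chi>s \<longleftrightarrow>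
     (\<forall>B. is_arg_max (\<lambda>\<chi>. \<Sum>a\<in>areas. B a \<chi>) (\<lambda>\<chi>. \<chi> \<in> {0, 1}) (\<chi>s B))"

definition groves_payment ::
    "(profile \<Rightarrow> bit) \<Rightarrow> (area \<Rightarrow> bid \<Rightarrow> real) \<Rightarrow> payment_rule" where
  "groves_payment \<chi>s h B a = B a (\<chi>s B) - (coalition_value B areas - h a (B (other a)))"

definition revealed_utility ::
    "(profile \<Rightarrow> bit) \<Rightarrow> payment_rule \<Rightarrow> profile \<Rightarrow> area \<Rightarrow> real" where
  "revealed_utility \<chi>s p B a = B a (\<chi>s B) - p B a"

definition strongly_budget_balanced_at :: "payment_rule \<Rightarrow> profile \<Rightarrow> bool" where
  "strongly_budget_balanced_at p B \<longleftrightarrow> p B A1 + p B A2 = 0"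

definition core :: "profile \<Rightarrow> real \<Rightarrow> (area \<Rightarrow> real) set" where
  "core B \<epsilon> = {u. (\<Sum>a\<in>areas. u a) = coalition_value B areas \<and>
                 (\<forall>S. S \<subset> areas \<longrightarrow> (\<Sum>a\<in>S. u a) \<ge> coalition_value B S - \<epsilon>)}"

definition coalitionally_stable_at ::
    "(profile \<Rightarrow> bit) \<Rightarrow> real \<Rightarrow> payment_rule \<Rightarrow> profile \<Rightarrow> bool" where
  "coalitionally_stable_at \<chi>s \<epsilon> p B \<longleftrightarrow> revealed_utility \<chi>s p B \<in> core B \<epsilon>"

end

(* Since the selected allocation attains the value V of the grand coalition, the payments of a
   Groves rule sum to h1(b2) + h2(b1) - V(b1, b2). Budget balance at all four profiles thus makes
   V additively separable in the two bids, whence V(b1, b2) + V(b1', b2') = V(b1, b2') + V(b1', b2).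
   Here V is 1 at one of the four profiles and 0 at the other three.
   The efficiency equation of the core is exactly budget balance, whatever the tolerance. *)
theory Submission
  imports Defs
begin

lemma coalition_value_maximizer:
  assumes "maximizer_selection \<chi>s"
  shows "coalition_value B areas = B A1 (\<chi>s B) + B A2 (\<chi>s B)"
proof -
  have "is_arg_max (\<lambda>\<chi>. B A1 \<chi> + B A2 \<chi>) (\<lambda>\<chi>. \<chi> \<in> {0, 1}) (\<chi>s B)"
    using assms by (simp add: maximizer_selection_def)
  then show ?thesis
    unfolding coalition_value_areas
    by (intro Max_eqI) (auto simp: is_arg_max_linorder)
qed

text \<open>The 0 in the maximum is the joint value of the default allocation.\<close>

lemma coalition_value_profile:
  assumes "b\<^sub>1 0 = 0" and "b\<^sub>2 0 = 0"
  shows "coalition_value (profile b\<^sub>1 b\<^sub>2) areas = max 0 (b\<^sub>1 1 + b\<^sub>2 1)"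
  unfolding coalition_value_areas using assms by (simp add: profile_def)

lemma groves_budget_balanced_iff:
  assumes "maximizer_selection \<chi>s"
  shows "strongly_budget_balanced_at (groves_payment \<chi>s h) B \<longleftrightarrow>
    coalition_value B areas = h A1 (B A2) + h A2 (B A1)"
  using coalition_value_maximizer[OF assms, of B]
  by (auto simp: strongly_budget_balanced_at_def groves_payment_def)

text \<open>Payments sum to the bids at the selected allocation minus the revealed utilities. The
  bids total V because that allocation is a maximizer, the utilities by efficiency, so the
  difference vanishes.\<close>

lemma coalitionally_stable_imp_budget_balanced:
  assumes "maximizer_selection \<chi>s" and "coalitionally_stable_at \<chi>s \<epsilon> p B"
  shows "strongly_budget_balanced_at p B"
  using assms(2) coalition_value_maximizer[OF assms(1), of B]
  by (simp add: coalitionally_stable_at_def core_def revealed_utility_def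
      strongly_budget_balanced_at_def)

text \<open>Each \<open>h\<close> term sees one bid only, so both sides add up the same four
  \<open>h\<close> values. This eliminates the unknown \<open>h\<close>.\<close>

lemma budget_balanced_value_exchange:
  assumes "maximizer_selection \<chi>s"
    and "\<And>x y. x \<in> {b\<^sub>1, c\<^sub>1} \<Longrightarrow> y \<in> {b\<^sub>2, c\<^sub>2} \<Longrightarrow>
      strongly_budget_balanced_at (groves_payment \<chi>s h) (profile x y)"
  shows "coalition_value (profile b\<^sub>1 b\<^sub>2) areas + coalition_value (profile c\<^sub>1 c\<^sub>2) areas =
    coalition_value (profile b\<^sub>1 c\<^sub>2) areas + coalition_value (profile c\<^sub>1 b\<^sub>2) areas"
proof -
  have "coalition_value (profile x y) areas = h A1 y + h A2 x"
    if "x \<in> {b\<^sub>1, c\<^sub>1}" and "y \<in> {b\<^sub>2, c\<^sub>2}" for x y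
    using assms(2)[OF that] by (simp add: groves_budget_balanced_iff[OF assms(1)] profile_def)
  then show ?thesis by simp
qed

theorem mainTheorem5:
  fixes b\<^sub>1 b\<^sub>2 :: "nat \<Rightarrow> bid"
    and \<chi>s :: "profile \<Rightarrow> bit"
  assumes "\<forall>i\<in>{1, 2}. b\<^sub>1 i 0 = 0" and "\<forall>j\<in>{1, 2}. b\<^sub>2 j 0 = 0"
    and "b\<^sub>1 1 1 = 1" and "b\<^sub>1 2 1 = 0"
    and "b\<^sub>2 1 1 = - 1" and "b\<^sub>2 2 1 = 0"
    and "maximizer_selection \<chi>s"
  shows "(\<nexists>h. \<forall>i\<in>{1, 2}. \<forall>j\<in>{1, 2}.
            strongly_budget_balanced_at (groves_payment \<chi>s h) (profile (b\<^sub>1 i) (b\<^sub>2 j))) \<and>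
         (\<nexists>\<epsilon> h. \<epsilon> \<ge> 0 \<and> (\<forall>i\<in>{1, 2}. \<forall>j\<in>{1, 2}.
            coalitionally_stable_at \<chi>s \<epsilon> (groves_payment \<chi>s h) (profile (b\<^sub>1 i) (b\<^sub>2 j))))"
proof -
  have unbalanced: False
    if bal: "\<forall>i\<in>{1, 2}. \<forall>j\<in>{1, 2}.
      strongly_budget_balanced_at (groves_payment \<chi>s h) (profile (b\<^sub>1 i) (b\<^sub>2 j))" for h
  proof -
    have V: "coalition_value (profile (b\<^sub>1 i) (b\<^sub>2 j)) areas = max 0 (b\<^sub>1 i 1 + b\<^sub>2 j 1)"
      if "i \<in> {1, 2}" and "j \<in> {1, 2}" for i j
      using assms(1,2) that by (intro coalition_value_profile) blast+
    have "coalition_value (profile (b\<^sub>1 1) (b\<^sub>2 1)) areas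
        + coalition_value (profile (b\<^sub>1 2) (b\<^sub>2 2)) areas =
      coalition_value (profile (b\<^sub>1 1) (b\<^sub>2 2)) areas
        + coalition_value (profile (b\<^sub>1 2) (b\<^sub>2 1)) areas"
      using bal by (intro budget_balanced_value_exchange[OF assms(7), where h = h]) blast
    \<comment> \<open>At the index pairs (1,1), (2,2) and (2,1) the value is 0, at (1,2) it is 1.
      The exchange equation thus reads 0 = 1.\<close>
    then show False
      using V[of 1 1] V[of 1 2] V[of 2 1] V[of 2 2] assms(3-6) by simp
  qed
  \<comment> \<open>For the second claim, stability at the four profiles yields balance there with
    the same \<open>h\<close>.\<close>
  then show ?thesis
    using coalitionally_stable_imp_budget_balanced[OF assms(7)] by blast
qed

end
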